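(* Let $\Lambda$ be a $k$-graph. Let $B_n$ be the $1$-graph with a single vertex $u$ and $n$ edges $f_1,\dots,f_n$ (i.e. the free monoid on $n$ generators). Let $\mu\mapsto\alpha_\mu$ be a functor from $B_n$ to $\operatorname{Aut}(\Lambda)$. Let $\Gamma=B_n\times\Lambda$ as a set; define $d:\Gamma\to\mathbb{N}^{k+1}$ by $d(\mu,\lambda)=(|\mu|,d(\lambda))$; define $r,s:\Gamma\to\Gamma^0=\{u\}\times\Lambda^0$ by $r(\mu,\lambda)=(u,\alpha_\mu(r(\lambda)))$ and $s(\mu,\lambda)=(u,s(\lambda))$; and define composition in $\Gamma$ by $$(\mu,\alpha_\nu(\lambda))(\nu,\xi)=(\mu\nu,\lambda\xi)\qquad(\mu,\nu\in B_n,\ \lambda,\xi\in\Lambda,\ s(\lambda)=r(\xi)).$$ Then $(\Gamma,d)$ is a $(k+1)$-graph. If $i_\Lambda:\Lambda\to\Pi(\Lambda)$ is injective, then $i_\Gamma:\Gamma\to\Pi(\Gamma)$ is injective.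
   Context: A $k$-graph is a small category $\Lambda$ (identified with its set of morphisms) with a functor $d:\Lambda\to\mathbb{N}^k$ satisfying the factorisation property: if $d(\lambda)=m+n$ there are unique $\mu,\nu\in\Lambda$ with $d(\mu)=m$, $d(\nu)=n$, $\lambda=\mu\nu$. $\Lambda^0=d^{-1}(0)$ is the set of identity morphisms (vertices); $r,s$ are the codomain and domain maps, so $\lambda\mu$ is defined iff $s(\lambda)=r(\mu)$. $\operatorname{Aut}(\Lambda)$ is the group of degree-preserving automorphisms of $\Lambda$. $|\mu|$ denotes the word length of $\mu\in B_n$. The fundamental groupoid of a $k$-graph $\Lambda$ is a groupoid $\Pi(\Lambda)$ with a functor $i=i_\Lambda:\Lambda\to\Pi(\Lambda)$, $i(\Lambda^0)=\Pi(\Lambda)^0$, such that every functor $F$ from $\Lambda$ to a groupoid $\mathcal G$ is $\tilde F\circ i$ for a unique groupoid homomorphism $\tilde F:\Pi(\Lambda)\to\mathcal G$. *)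

theory Defs
  imports "HOL-Algebra.Bij"
begin

section \<open>Categories, functors and groupoids\<close>

text \<open>
  A small category is identified with its set of morphisms, and objects with identity
  morphisms. Composition follows the convention \<open>s(\<lambda>) = r(\<mu>)\<close> for \<open>\<lambda>\<mu>\<close>; the value of \<open>cmp\<close> at
  non-composable pairs, and of all operations outside \<open>Mor\<close>, is irrelevant.
\<close>

record 'a cat =
  Mor :: "'a set"
  rng :: "'a \<Rightarrow> 'a"
  src :: "'a \<Rightarrow> 'a"
  cmp :: "'a \<Rightarrow> 'a \<Rightarrow> 'a"

locale category =
  fixes C :: "('a, 'm) cat_scheme"
  assumes rng_Mor: "x \<in> Mor C \<Longrightarrow> rng C x \<in> Mor C"
    and src_Mor: "x \<in> Mor C \<Longrightarrow> src C x \<in> Mor C"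
    and rng_rng: "x \<in> Mor C \<Longrightarrow> rng C (rng C x) = rng C x"
    and src_rng: "x \<in> Mor C \<Longrightarrow> src C (rng C x) = rng C x"
    and rng_src: "x \<in> Mor C \<Longrightarrow> rng C (src C x) = src C x"
    and src_src: "x \<in> Mor C \<Longrightarrow> src C (src C x) = src C x"
    and cmp_Mor: "\<lbrakk>x \<in> Mor C; y \<in> Mor C; src C x = rng C y\<rbrakk> \<Longrightarrow> cmp C x y \<in> Mor C"
    and rng_cmp: "\<lbrakk>x \<in> Mor C; y \<in> Mor C; src C x = rng C y\<rbrakk> \<Longrightarrow> rng C (cmp C x y) = rng C x"
    and src_cmp: "\<lbrakk>x \<in> Mor C; y \<in> Mor C; src C x = rng C y\<rbrakk> \<Longrightarrow> src C (cmp C x y) = src C y"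
    and rng_unit: "x \<in> Mor C \<Longrightarrow> cmp C (rng C x) x = x"
    and src_unit: "x \<in> Mor C \<Longrightarrow> cmp C x (src C x) = x"
    and cmp_assoc: "\<lbrakk>x \<in> Mor C; y \<in> Mor C; z \<in> Mor C; src C x = rng C y; src C y = rng C z\<rbrakk>
      \<Longrightarrow> cmp C (cmp C x y) z = cmp C x (cmp C y z)"

definition Ob :: "('a, 'm) cat_scheme \<Rightarrow> 'a set" where
  "Ob C = {v \<in> Mor C. rng C v = v}"

definition is_functor ::
  "('a, 'm) cat_scheme \<Rightarrow> ('b, 'n) cat_scheme \<Rightarrow> ('a \<Rightarrow> 'b) \<Rightarrow> bool" where
  "is_functor C D F \<longleftrightarrow>
     (\<forall>x \<in> Mor C. F x \<in> Mor D \<and> F (rng C x) = rng D (F x) \<and> F (src C x) = src D (F x)) \<and>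
     (\<forall>x \<in> Mor C. \<forall>y \<in> Mor C. src C x = rng C y \<longrightarrow> F (cmp C x y) = cmp D (F x) (F y))"

locale groupoid = category +
  assumes inverse_ex: "x \<in> Mor C \<Longrightarrow>
    \<exists>y \<in> Mor C. rng C y = src C x \<and> src C y = rng C x \<and>
      cmp C x y = rng C x \<and> cmp C y x = src C x"

text \<open>A monoid as a category with one object.\<close>

definition one_object :: "('a, 'm) monoid_scheme \<Rightarrow> 'a cat" where
  "one_object M = \<lparr>Mor = carrier M, rng = (\<lambda>_. one M), src = (\<lambda>_. one M), cmp = mult M\<rparr>"

lemma category_one_object: "monoid M \<Longrightarrow> category (one_object M)"
  by unfold_locales (auto simp: one_object_def monoid.one_closed monoid.m_closed monoid.l_one
      monoid.r_one monoid.m_assoc)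


section \<open>Higher-rank graphs\<close>

text \<open>The monoid of \<open>k\<close>-tuples of natural numbers, encoded as the functions vanishing from \<open>k\<close> on.\<close>

definition degree_monoid :: "nat \<Rightarrow> (nat \<Rightarrow> nat) monoid" where
  "degree_monoid k =
     \<lparr>carrier = {m. \<forall>i\<ge>k. m i = 0}, mult = (\<lambda>m n i. m i + n i), one = (\<lambda>_. 0)\<rparr>"

lemma monoid_degree_monoid: "monoid (degree_monoid k)"
  by unfold_locales (auto simp: degree_monoid_def)

record 'a kgraph = "'a cat" +
  deg :: "'a \<Rightarrow> nat \<Rightarrow> nat"

locale k_graph = category L
  for k :: nat and L :: "('a, 'm) kgraph_scheme" +
  assumes deg_functor: "is_functor L (one_object (degree_monoid k)) (deg L)"
    and factorisation:
      "\<lbrakk>x \<in> Mor L; m \<in> carrier (degree_monoid k); n \<in> carrier (degree_monoid k);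
        deg L x = m \<otimes>\<^bsub>degree_monoid k\<^esub> n\<rbrakk>
      \<Longrightarrow> \<exists>!(y, z). y \<in> Mor L \<and> z \<in> Mor L \<and> src L y = rng L z \<and>
            deg L y = m \<and> deg L z = n \<and> x = cmp L y z"

lemma (in k_graph) Ob_eq_degree_zero: "Ob L = {x \<in> Mor L. deg L x = (\<lambda>_. 0)}"
proof (intro equalityI subsetI)
  fix v assume "v \<in> Ob L"
  then have v: "v \<in> Mor L" "rng L v = v" by (auto simp: Ob_def)
  then have "deg L v = one (degree_monoid k)"
    using deg_functor unfolding is_functor_def one_object_def by (metis cat.select_convs(2))
  then show "v \<in> {x \<in> Mor L. deg L x = (\<lambda>_. 0)}" using v by (simp add: degree_monoid_def)
next
  fix x assume "x \<in> {x \<in> Mor L. deg L x = (\<lambda>_. 0)}"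
  then have x: "x \<in> Mor L" "deg L x = (\<lambda>_. 0)" by auto
  have d: "deg L (rng L x) = (\<lambda>_. 0)" "deg L (src L x) = (\<lambda>_. 0)"
    using deg_functor x unfolding is_functor_def one_object_def degree_monoid_def by auto
  define P where "P = (\<lambda>(y, z). y \<in> Mor L \<and> z \<in> Mor L \<and> src L y = rng L z \<and>
            deg L y = (\<lambda>_. 0) \<and> deg L z = (\<lambda>_. 0) \<and> x = cmp L y z)"
  have "\<exists>!p. P p"
    unfolding P_def using x by (intro factorisation) (auto simp: degree_monoid_def)
  moreover have "P (rng L x, x)" "P (x, src L x)"
    using x d by (auto simp: P_def rng_Mor src_Mor src_rng rng_src rng_unit src_unit)
  ultimately have "(rng L x, x) = (x, src L x)" by blast
  then show "x \<in> Ob L" using x by (auto simp: Ob_def)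
qed

definition Aut :: "('a, 'm) kgraph_scheme \<Rightarrow> ('a \<Rightarrow> 'a) monoid" where
  "Aut L = BijGroup (Mor L)
     \<lparr>carrier := {f \<in> Bij (Mor L). is_functor L L f \<and> (\<forall>x \<in> Mor L. deg L (f x) = deg L x)}\<rparr>"

lemma group_Aut:
  fixes L :: "('a, 'm) kgraph_scheme"
  assumes "category L"
  shows "group (Aut L)"
proof -
  interpret L: category L by fact
  have sub: "subgroup (carrier (Aut L)) (BijGroup (Mor L))"
  proof (rule group.subgroupI[OF group_BijGroup])
    show "carrier (Aut L) \<subseteq> carrier (BijGroup (Mor L))"
      by (auto simp: Aut_def BijGroup_def)
    have "(\<lambda>x\<in>Mor L. x) \<in> carrier (Aut L)"
      by (auto simp: Aut_def id_Bij is_functor_def L.rng_Mor L.src_Mor L.cmp_Mor)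
    then show "carrier (Aut L) \<noteq> {}" by auto
  next
    fix f assume f: "f \<in> carrier (Aut L)"
    then have B: "f \<in> Bij (Mor L)" by (simp add: Aut_def)
    define g where "g = (\<lambda>x\<in>Mor L. (inv_into (Mor L) f) x)"
    have bij: "bij_betw f (Mor L) (Mor L)" using B by (simp add: Bij_def)
    have gf: "g (f x) = x" if "x \<in> Mor L" for x
      using that bij by (auto simp: g_def bij_betw_def inv_into_f_f)
    have ex: "\<exists>x'\<in>Mor L. x = f x'" if "x \<in> Mor L" for x
      using that bij by (auto simp: bij_betw_def)
    have "is_functor L L g"
      unfolding is_functor_def
    proof (intro conjI ballI impI)
      fix x assume "x \<in> Mor L"
      then obtain x' where x: "x' \<in> Mor L" "x = f x'" using ex by auto
      have "rng L x = f (rng L x')" "src L x = f (src L x')"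
        using f x by (auto simp: Aut_def is_functor_def)
      with x show "g x \<in> Mor L" "g (rng L x) = rng L (g x)" "g (src L x) = src L (g x)"
        by (auto simp: gf L.rng_Mor L.src_Mor)
    next
      fix x y assume "x \<in> Mor L" "y \<in> Mor L" and c: "src L x = rng L y"
      then obtain x' y' where x: "x' \<in> Mor L" "x = f x'" "y' \<in> Mor L" "y = f y'" using ex by metis
      have "f (src L x') = f (rng L y')"
        using f x c by (auto simp: Aut_def is_functor_def)
      then have c': "src L x' = rng L y'" using x gf by (metis L.rng_Mor L.src_Mor)
      then have "cmp L x y = f (cmp L x' y')" using f x by (auto simp: Aut_def is_functor_def)
      with x c' show "g (cmp L x y) = cmp L (g x) (g y)" by (auto simp: gf L.cmp_Mor)
    qed
    moreover have "\<forall>x\<in>Mor L. deg L (g x) = deg L x"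
      using ex gf f by (fastforce simp: Aut_def)
    ultimately show "inv\<^bsub>BijGroup (Mor L)\<^esub> f \<in> carrier (Aut L)"
      using B by (simp add: inv_BijGroup Aut_def g_def restrict_inv_into_Bij)
  next
    fix f g assume fg: "f \<in> carrier (Aut L)" "g \<in> carrier (Aut L)"
    have "compose (Mor L) f g \<in> Bij (Mor L)" using fg by (simp add: Aut_def compose_Bij)
    moreover have "is_functor L L (compose (Mor L) f g)"
      unfolding is_functor_def
    proof (intro conjI ballI impI)
      fix x y assume xy: "x \<in> Mor L" "y \<in> Mor L" "src L x = rng L y"
      have G: "g x \<in> Mor L" "g y \<in> Mor L" "src L (g x) = rng L (g y)" "g (cmp L x y) = cmp L (g x) (g y)"
        using fg xy by (auto simp: Aut_def is_functor_def) metis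
      then have "f (cmp L (g x) (g y)) = cmp L (f (g x)) (f (g y))"
        using fg by (auto simp: Aut_def is_functor_def)
      with G xy show "compose (Mor L) f g (cmp L x y) = cmp L (compose (Mor L) f g x) (compose (Mor L) f g y)"
        by (simp add: compose_def L.cmp_Mor)
    qed (use fg in \<open>auto simp: Aut_def is_functor_def compose_def L.rng_Mor L.src_Mor\<close>)
    ultimately show "f \<otimes>\<^bsub>BijGroup (Mor L)\<^esub> g \<in> carrier (Aut L)"
      using fg by (auto simp: Aut_def BijGroup_def compose_def is_functor_def)
  qed
  show ?thesis
    using group.subgroup_imp_group[OF group_BijGroup sub] by (simp add: Aut_def)
qed

text \<open>
  The \<open>1\<close>-graph with a single vertex and \<open>n\<close> edges: words in \<open>{..<n}\<close> under concatenation, the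
  empty word being the vertex \<open>u\<close>.
\<close>

definition Bn :: "nat \<Rightarrow> nat list kgraph" where
  "Bn n = \<lparr>Mor = lists {..<n}, rng = (\<lambda>_. []), src = (\<lambda>_. []), cmp = (@),
           deg = (\<lambda>\<mu>. case_nat (length \<mu>) (\<lambda>_. 0))\<rparr>"

lemma k_graph_Bn: "k_graph 1 (Bn n)"
proof
  fix x m m'
  assume x: "x \<in> Mor (Bn n)" and m: "m \<in> carrier (degree_monoid 1)" "m' \<in> carrier (degree_monoid 1)"
    and d: "deg (Bn n) x = m \<otimes>\<^bsub>degree_monoid 1\<^esub> m'"
  have "length x = m 0 + m' 0"
    using fun_cong[OF d, of 0] by (simp add: Bn_def degree_monoid_def)
  moreover have "deg (Bn n) y = m \<longleftrightarrow> length y = m 0" "deg (Bn n) y = m' \<longleftrightarrow> length y = m' 0" for y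
    using m by (auto simp: Bn_def degree_monoid_def fun_eq_iff split: nat.split)
  ultimately show "\<exists>!(y, z). y \<in> Mor (Bn n) \<and> z \<in> Mor (Bn n) \<and> src (Bn n) y = rng (Bn n) z \<and>
            deg (Bn n) y = m \<and> deg (Bn n) z = m' \<and> x = cmp (Bn n) y z"
    using x
    by (intro ex1I[of _ "(take (m 0) x, drop (m 0) x)"])
       (auto simp: Bn_def in_lists_conv_set dest: in_set_takeD in_set_dropD)
qed (auto simp: Bn_def is_functor_def one_object_def degree_monoid_def split: nat.split)


section \<open>The crossed product graph\<close>

text \<open>
  Since \<open>\<alpha>\<^sub>\<nu>\<close> is a bijection, the rule \<open>(\<mu>, \<alpha>\<^sub>\<nu>(\<lambda>))(\<nu>, \<xi>) = (\<mu>\<nu>, \<lambda>\<xi>)\<close> determines \<open>\<lambda>\<close> from the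
  second component of the left factor. The degree places \<open>|\<mu>|\<close> in coordinate \<open>0\<close>
  and shifts \<open>d(\<lambda>)\<close> by one.
\<close>

definition Gam ::
  "nat \<Rightarrow> ('a, 'm) kgraph_scheme \<Rightarrow> (nat list \<Rightarrow> 'a \<Rightarrow> 'a) \<Rightarrow> (nat list \<times> 'a) kgraph" where
  "Gam n L \<alpha> =
     \<lparr>Mor = Mor (Bn n) \<times> Mor L,
      rng = (\<lambda>(\<mu>, x). ([], \<alpha> \<mu> (rng L x))),
      src = (\<lambda>(\<mu>, x). ([], src L x)),
      cmp = (\<lambda>(\<mu>, y) (\<nu>, z). (\<mu> @ \<nu>, cmp L (inv_into (Mor L) (\<alpha> \<nu>) y) z)),
      deg = (\<lambda>(\<mu>, x). case_nat (length \<mu>) (deg L x))\<rparr>"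

lemma cmp_Gam:
  assumes "is_functor (Bn n) (one_object (Aut L)) \<alpha>" "\<nu> \<in> Mor (Bn n)" "x \<in> Mor L"
  shows "cmp (Gam n L \<alpha>) (\<mu>, \<alpha> \<nu> x) (\<nu>, z) = (\<mu> @ \<nu>, cmp L x z)"
proof -
  have "\<alpha> \<nu> \<in> Bij (Mor L)"
    using assms by (auto simp: is_functor_def one_object_def Aut_def)
  then show ?thesis
    using assms by (simp add: Gam_def Bij_def bij_betw_def inv_into_f_f)
qed
lemma Ob_Gam:
  assumes "category L" "is_functor (Bn n) (one_object (Aut L)) \<alpha>"
  shows "Ob (Gam n L \<alpha>) = {[]} \<times> Ob L"
proof -
  interpret category L by fact
  have "\<alpha> [] = (\<lambda>x\<in>Mor L. x)"
    using assms(2) by (auto simp: is_functor_def one_object_def Aut_def BijGroup_def Bn_def)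
  then show ?thesis by (auto simp: Ob_def Gam_def Bn_def rng_Mor)
qed


section \<open>The fundamental groupoid\<close>

text \<open>
  The universal property with respect to groupoids whose morphisms form a subset of the
  type \<open>'h\<close>. Functors are compared on morphisms only.
\<close>

definition universal_to :: "'h itself \<Rightarrow> ('a, 'm) cat_scheme \<Rightarrow> 'p cat \<Rightarrow> ('a \<Rightarrow> 'p) \<Rightarrow> bool" where
  "universal_to _ C P i \<longleftrightarrow>
     (\<forall>(G :: 'h cat) F. groupoid G \<and> is_functor C G F \<longrightarrow>
        (\<exists>F'. is_functor P G F' \<and> (\<forall>x \<in> Mor C. F' (i x) = F x) \<and>
           (\<forall>F''. is_functor P G F'' \<and> (\<forall>x \<in> Mor C. F'' (i x) = F x) \<longrightarrow>
              (\<forall>p \<in> Mor P. F'' p = F' p))))"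

text \<open>
  A definition cannot quantify over all types, so the property is required for groupoids over the
  type of \<open>P\<close> itself and over the type \<open>('a \<times> bool) list set\<close>, in which the groupoid of
  equivalence classes of zig-zag paths of \<open>C\<close> can be constructed. This is no restriction: by the
  theorems \<open>fundamental_groupoid_universal\<close> and \<open>fundamental_groupoid_exists\<close> below the
  property then holds over every type, and a fundamental groupoid always exists.
\<close>

definition fundamental_groupoid :: "('a, 'm) cat_scheme \<Rightarrow> 'p cat \<Rightarrow> ('a \<Rightarrow> 'p) \<Rightarrow> bool" where
  "fundamental_groupoid C P i \<longleftrightarrow>
     groupoid P \<and> is_functor C P i \<and> i ` Ob C = Ob P \<and>
     universal_to TYPE('p) C P i \<and> universal_to TYPE(('a \<times> bool) list set) C P i"


subsection \<open>Existence, by zig-zag paths\<close>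

text \<open>The letter \<open>(x, True)\<close> stands for \<open>x\<close> and \<open>(x, False)\<close> for its formal inverse.\<close>

definition lrng :: "('a, 'm) cat_scheme \<Rightarrow> 'a \<times> bool \<Rightarrow> 'a" where
  "lrng C a = (if snd a then rng C (fst a) else src C (fst a))"

definition lsrc :: "('a, 'm) cat_scheme \<Rightarrow> 'a \<times> bool \<Rightarrow> 'a" where
  "lsrc C a = (if snd a then src C (fst a) else rng C (fst a))"

fun zpath :: "('a, 'm) cat_scheme \<Rightarrow> ('a \<times> bool) list \<Rightarrow> bool" where
  "zpath C [] \<longleftrightarrow> False"
| "zpath C [a] \<longleftrightarrow> fst a \<in> Mor C"
| "zpath C (a # b # w) \<longleftrightarrow> fst a \<in> Mor C \<and> lsrc C a = lrng C b \<and> zpath C (b # w)"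

inductive zeq :: "('a, 'm) cat_scheme \<Rightarrow> ('a \<times> bool) list \<Rightarrow> ('a \<times> bool) list \<Rightarrow> bool"
  for C where
  zrefl: "zeq C w w"
| zsym: "zeq C v w \<Longrightarrow> zeq C w v"
| ztrans: "zeq C u v \<Longrightarrow> zeq C v w \<Longrightarrow> zeq C u w"
| zcons: "zeq C v w \<Longrightarrow> zeq C (a # v) (a # w)"
| zsnoc: "zeq C v w \<Longrightarrow> zeq C (v @ [a]) (w @ [a])"
| zcmp: "x \<in> Mor C \<Longrightarrow> y \<in> Mor C \<Longrightarrow> src C x = rng C y \<Longrightarrow>
    zeq C [(x, True), (y, True)] [(cmp C x y, True)]"
| zrinv: "x \<in> Mor C \<Longrightarrow> zeq C [(x, True), (x, False)] [(rng C x, True)]"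
| zlinv: "x \<in> Mor C \<Longrightarrow> zeq C [(x, False), (x, True)] [(src C x, True)]"
| zlunit: "x \<in> Mor C \<Longrightarrow> zeq C [(src C x, True), (x, False)] [(x, False)]"
| zrunit: "x \<in> Mor C \<Longrightarrow> zeq C [(x, False), (rng C x, True)] [(x, False)]"

definition zcls :: "('a, 'm) cat_scheme \<Rightarrow> ('a \<times> bool) list \<Rightarrow> ('a \<times> bool) list set" where
  "zcls C w = {v. zeq C w v}"

definition zrep :: "'b set \<Rightarrow> 'b" where
  "zrep A = (SOME w. w \<in> A)"

definition zgroupoid :: "('a, 'm) cat_scheme \<Rightarrow> ('a \<times> bool) list set cat" where
  "zgroupoid C =
     \<lparr>Mor = zcls C ` {w. zpath C w},
      rng = (\<lambda>A. zcls C [(lrng C (hd (zrep A)), True)]),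
      src = (\<lambda>A. zcls C [(lsrc C (last (zrep A)), True)]),
      cmp = (\<lambda>A B. zcls C (zrep A @ zrep B))\<rparr>"

definition zmap :: "('a, 'm) cat_scheme \<Rightarrow> 'a \<Rightarrow> ('a \<times> bool) list set" where
  "zmap C x = zcls C [(x, True)]"

lemma zpath_append:
  "u \<noteq> [] \<Longrightarrow> v \<noteq> [] \<Longrightarrow>
    zpath C (u @ v) \<longleftrightarrow> zpath C u \<and> zpath C v \<and> lsrc C (last u) = lrng C (hd v)"
proof (induction u)
  case (Cons a u)
  then show ?case by (cases u; cases v) auto
qed auto

lemma zeq_append: "zeq C u u' \<Longrightarrow> zeq C v v' \<Longrightarrow> zeq C (u @ v) (u' @ v')"
proof -
  assume uv: "zeq C u u'" "zeq C v v'"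
  have "zeq C (u @ v) (u @ v')"
    by (induction u) (auto intro: uv zcons)
  moreover have "zeq C (u @ v') (u' @ v')"
  proof (induction v' rule: rev_induct)
    case (snoc a v')
    then show ?case using zsnoc[of C "u @ v'" "u' @ v'" a] by simp
  qed (simp add: uv)
  ultimately show ?thesis by (rule ztrans)
qed

lemma zcls_eq_iff: "zcls C v = zcls C w \<longleftrightarrow> zeq C v w"
  by (auto simp: zcls_def set_eq_iff intro: zrefl zsym ztrans)

lemma zeq_zrep: "zeq C w (zrep (zcls C w))"
proof -
  have "w \<in> zcls C w" by (simp add: zcls_def zrefl)
  then have "zrep (zcls C w) \<in> zcls C w" unfolding zrep_def by (rule someI)
  then show ?thesis by (simp add: zcls_def)
qed

context category begin

definition zinv where
  "zinv v w \<longleftrightarrow> (v = [] \<longleftrightarrow> w = []) \<and> (zpath C v \<longleftrightarrow> zpath C w) \<and>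
     (v \<noteq> [] \<longrightarrow> lrng C (hd v) = lrng C (hd w) \<and> lsrc C (last v) = lsrc C (last w))"

lemma zeq_zinv: "zeq C v w \<Longrightarrow> zinv v w"
proof (induction rule: zeq.induct)
  case (zcons v w a)
  then show ?case
    by (cases "v = []") (use zpath_append[of "[a]" _ C] in \<open>auto simp: zinv_def\<close>)
next
  case (zsnoc v w a)
  then show ?case
    by (cases "v = []") (auto simp: zinv_def zpath_append)
qed (auto simp: zinv_def lrng_def lsrc_def rng_Mor src_Mor rng_rng rng_src src_rng src_src
       cmp_Mor rng_cmp src_cmp)

lemma zpath_nonempty: "zpath C w \<Longrightarrow> w \<noteq> []" by auto

lemma lrng_Mor: "zpath C w \<Longrightarrow> lrng C (hd w) \<in> Mor C"
  by (cases "(C, w)" rule: zpath.cases) (auto simp: lrng_def rng_Mor src_Mor)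

lemma lsrc_Mor: "zpath C w \<Longrightarrow> lsrc C (last w) \<in> Mor C"
  by (cases w rule: rev_exhaust; cases "butlast w = []")
     (auto simp: lsrc_def rng_Mor src_Mor zpath_append)

lemma rng_lrng: "zpath C w \<Longrightarrow> rng C (lrng C (hd w)) = lrng C (hd w)"
  by (cases "(C, w)" rule: zpath.cases) (auto simp: lrng_def rng_rng rng_src)

lemma src_lrng: "zpath C w \<Longrightarrow> src C (lrng C (hd w)) = lrng C (hd w)"
  by (cases "(C, w)" rule: zpath.cases) (auto simp: lrng_def src_rng src_src)

lemma lsrc_fix: "zpath C w \<Longrightarrow> rng C (lsrc C (last w)) = lsrc C (last w) \<and>
    src C (lsrc C (last w)) = lsrc C (last w)"
  by (cases w rule: rev_exhaust; cases "butlast w = []")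
     (auto simp: lsrc_def rng_rng rng_src src_rng src_src zpath_append)

lemma zMor [simp]: "zcls C w \<in> Mor (zgroupoid C) \<longleftrightarrow> zpath C w"
  using zeq_zinv by (force simp: zgroupoid_def zcls_eq_iff zinv_def)

lemma zMorE:
  assumes "A \<in> Mor (zgroupoid C)" obtains w where "A = zcls C w" "zpath C w"
  using assms by (auto simp: zgroupoid_def)

lemma zrng: "zpath C w \<Longrightarrow> rng (zgroupoid C) (zcls C w) = zcls C [(lrng C (hd w), True)]"
proof -
  assume "zpath C w"
  then have "lrng C (hd (zrep (zcls C w))) = lrng C (hd w)"
    using zeq_zinv[OF zeq_zrep[of C w]] unfolding zinv_def by (metis zpath_nonempty)
  then show ?thesis by (simp add: zgroupoid_def)
qed

lemma zsrc: "zpath C w \<Longrightarrow> src (zgroupoid C) (zcls C w) = zcls C [(lsrc C (last w), True)]"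
proof -
  assume "zpath C w"
  then have "lsrc C (last (zrep (zcls C w))) = lsrc C (last w)"
    using zeq_zinv[OF zeq_zrep[of C w]] unfolding zinv_def by (metis zpath_nonempty)
  then show ?thesis by (simp add: zgroupoid_def)
qed

lemma zcomp: "cmp (zgroupoid C) (zcls C v) (zcls C w) = zcls C (v @ w)"
  by (simp add: zgroupoid_def zcls_eq_iff zsym zeq_append zeq_zrep)

lemma zsrc_eq_zrng:
  assumes "zpath C v" "zpath C w"
  shows "src (zgroupoid C) (zcls C v) = rng (zgroupoid C) (zcls C w) \<longleftrightarrow>
    lsrc C (last v) = lrng C (hd w)"
proof -
  have "rng C (lsrc C (last v)) = lsrc C (last v)" "rng C (lrng C (hd w)) = lrng C (hd w)"
    using assms by (auto simp: lsrc_fix rng_lrng)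
  then show ?thesis
    using assms zeq_zinv[of "[(lsrc C (last v), True)]" "[(lrng C (hd w), True)]"]
    by (auto simp: zsrc zrng zcls_eq_iff zinv_def lrng_def intro: zrefl)
qed

lemma zeq_lunit:
  assumes "zpath C w" shows "zeq C ((lrng C (hd w), True) # w) w"
proof -
  obtain x b v where w: "w = (x, b) # v" using assms by (cases w) auto
  then have x: "x \<in> Mor C" using assms by (cases v) auto
  have "zeq C [(lrng C (x, b), True), (x, b)] [(x, b)]"
    using x zcmp[of "rng C x" C x] zlunit[of x C]
    by (cases b) (auto simp: lrng_def rng_Mor src_rng rng_unit)
  from zeq_append[OF this zrefl[of C v]] show ?thesis by (simp add: w)
qed

lemma zeq_runit:
  assumes "zpath C w" shows "zeq C (w @ [(lsrc C (last w), True)]) w"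
proof -
  obtain x b v where w: "w = v @ [(x, b)]" using assms by (cases w rule: rev_exhaust) auto
  then have x: "x \<in> Mor C" using assms by (cases "v = []") (auto simp: zpath_append)
  have "zeq C [(x, b), (lsrc C (x, b), True)] [(x, b)]"
    using x zcmp[of x C "src C x"] zrunit[of x C]
    by (cases b) (auto simp: lsrc_def src_Mor rng_src src_unit)
  from zeq_append[OF zrefl[of C v] this] show ?thesis by (simp add: w)
qed

lemma category_zgroupoid: "category (zgroupoid C)"
proof
  fix A assume "A \<in> Mor (zgroupoid C)"
  then obtain w where w: "A = zcls C w" "zpath C w" by (rule zMorE)
  have l: "zpath C [(lrng C (hd w), True)]" "zpath C [(lsrc C (last w), True)]"
    using w by (auto simp: lrng_Mor lsrc_Mor)
  show "rng (zgroupoid C) A \<in> Mor (zgroupoid C)" "src (zgroupoid C) A \<in> Mor (zgroupoid C)"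
    using w l by (auto simp: zrng zsrc)
  show "rng (zgroupoid C) (rng (zgroupoid C) A) = rng (zgroupoid C) A"
    "src (zgroupoid C) (rng (zgroupoid C) A) = rng (zgroupoid C) A"
    "rng (zgroupoid C) (src (zgroupoid C) A) = src (zgroupoid C) A"
    "src (zgroupoid C) (src (zgroupoid C) A) = src (zgroupoid C) A"
    using w l lsrc_fix[of w] rng_lrng[of w] src_lrng[of w]
    by (auto simp: zrng zsrc lrng_def[of C "(_, True)"] lsrc_def[of C "(_, True)"])
  show "cmp (zgroupoid C) (rng (zgroupoid C) A) A = A"
    "cmp (zgroupoid C) A (src (zgroupoid C) A) = A"
    using w by (auto simp: zrng zsrc zcomp zcls_eq_iff zeq_lunit zeq_runit)
next
  fix A B assume AB: "A \<in> Mor (zgroupoid C)" "B \<in> Mor (zgroupoid C)"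
    and c: "src (zgroupoid C) A = rng (zgroupoid C) B"
  from AB obtain v w where vw: "A = zcls C v" "zpath C v" "B = zcls C w" "zpath C w"
    by (meson zMorE)
  have p: "zpath C (v @ w)" using vw c by (auto simp: zpath_append zpath_nonempty zsrc_eq_zrng)
  then show "cmp (zgroupoid C) A B \<in> Mor (zgroupoid C)"
    "rng (zgroupoid C) (cmp (zgroupoid C) A B) = rng (zgroupoid C) A"
    "src (zgroupoid C) (cmp (zgroupoid C) A B) = src (zgroupoid C) B"
    using vw zpath_nonempty by (auto simp: zcomp zrng zsrc)
next
  fix A B D assume "A \<in> Mor (zgroupoid C)" "B \<in> Mor (zgroupoid C)" "D \<in> Mor (zgroupoid C)"
  then show "cmp (zgroupoid C) (cmp (zgroupoid C) A B) D =
      cmp (zgroupoid C) A (cmp (zgroupoid C) B D)"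
    by (metis zMorE zcomp append_assoc)
qed

definition lflip :: "'a \<times> bool \<Rightarrow> 'a \<times> bool" where
  "lflip a = (fst a, \<not> snd a)"

lemma lflip_simps [simp]: "lrng C (lflip a) = lsrc C a" "lsrc C (lflip a) = lrng C a" "fst (lflip a) = fst a"
  by (auto simp: lflip_def lrng_def lsrc_def)

lemma zeq_linv: "fst a \<in> Mor C \<Longrightarrow> zeq C [lflip a, a] [(lsrc C a, True)]"
  by (cases a; cases "snd a") (auto simp: lflip_def lsrc_def intro: zeq.intros)

lemma zeq_rinv: "fst a \<in> Mor C \<Longrightarrow> zeq C [a, lflip a] [(lrng C a, True)]"
  by (cases a; cases "snd a") (auto simp: lflip_def lrng_def intro: zeq.intros)

lemma zinverse:
  "zpath C w \<Longrightarrow> \<exists>v. zpath C v \<and> lrng C (hd v) = lsrc C (last w) \<and> lsrc C (last v) = lrng C (hd w) \<and>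
     zeq C (w @ v) [(lrng C (hd w), True)] \<and> zeq C (v @ w) [(lsrc C (last w), True)]"
proof (induction w)
  case (Cons a w)
  then have a: "fst a \<in> Mor C" by (cases w) auto
  show ?case
  proof (cases "w = []")
    case True
    then show ?thesis using a zeq_linv zeq_rinv by (intro exI[of _ "[lflip a]"]) auto
  next
    case False
    then have w: "zpath C w" "lsrc C a = lrng C (hd w)" using Cons.prems by (cases w; auto)+
    from Cons.IH[OF w(1)] obtain v where v: "zpath C v" "lrng C (hd v) = lsrc C (last w)"
      "lsrc C (last v) = lrng C (hd w)" "zeq C (w @ v) [(lrng C (hd w), True)]"
      "zeq C (v @ w) [(lsrc C (last w), True)]" by blast
    have ne: "v \<noteq> []" using v by auto
    have "zeq C ((a # w) @ (v @ [lflip a])) [a, (lsrc C a, True), lflip a]"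
      using zeq_append[OF zrefl[of C "[a]"] zeq_append[OF v(4) zrefl[of C "[lflip a]"]]] w by simp
    also have "zeq C [a, (lsrc C a, True), lflip a] [a, lflip a]"
      using zeq_append[OF zeq_runit[of "[a]"] zrefl[of C "[lflip a]"]] a by simp
    also (ztrans) have "zeq C [a, lflip a] [(lrng C a, True)]" using a by (rule zeq_rinv)
    finally (ztrans) have 1: "zeq C ((a # w) @ (v @ [lflip a])) [(lrng C a, True)]" .
    have "zeq C ((v @ [lflip a]) @ (a # w)) (v @ [(lsrc C a, True)] @ w)"
      using zeq_append[OF zrefl[of C v] zeq_append[OF zeq_linv[OF a] zrefl[of C w]]] by simp
    also have "zeq C (v @ [(lsrc C a, True)] @ w) (v @ w)"
      using zeq_append[OF zrefl[of C v] zeq_lunit[OF w(1)]] w by simp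
    also (ztrans) note v(5)
    finally (ztrans) have 2: "zeq C ((v @ [lflip a]) @ (a # w)) [(lsrc C (last w), True)]" .
    show ?thesis
      using 1 2 v w a False ne by (intro exI[of _ "v @ [lflip a]"]) (auto simp: zpath_append)
  qed
qed auto

lemma groupoid_zgroupoid: "groupoid (zgroupoid C)"
proof -
  interpret Z: category "zgroupoid C" by (rule category_zgroupoid)
  show ?thesis
  proof
    fix A assume "A \<in> Mor (zgroupoid C)"
    then obtain w where w: "A = zcls C w" "zpath C w" by (rule zMorE)
    from zinverse[OF w(2)] obtain v where "zpath C v" "lrng C (hd v) = lsrc C (last w)"
      "lsrc C (last v) = lrng C (hd w)" "zeq C (w @ v) [(lrng C (hd w), True)]"
      "zeq C (v @ w) [(lsrc C (last w), True)]" by blast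
    then show "\<exists>B\<in>Mor (zgroupoid C). rng (zgroupoid C) B = src (zgroupoid C) A \<and>
        src (zgroupoid C) B = rng (zgroupoid C) A \<and>
        cmp (zgroupoid C) A B = rng (zgroupoid C) A \<and> cmp (zgroupoid C) B A = src (zgroupoid C) A"
      using w by (intro bexI[of _ "zcls C v"]) (auto simp: zrng zsrc zcomp zcls_eq_iff)
  qed
qed

lemma is_functor_zmap: "is_functor C (zgroupoid C) (zmap C)"
  by (auto simp: is_functor_def zmap_def zrng zsrc zcomp zcls_eq_iff lrng_def lsrc_def
      intro: zsym zcmp zrefl)

lemma zmap_Ob: "zmap C ` Ob C = Ob (zgroupoid C)"
proof (intro equalityI subsetI)
  fix A assume "A \<in> zmap C ` Ob C"
  then show "A \<in> Ob (zgroupoid C)"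
    by (auto simp: Ob_def zmap_def zrng lrng_def)
next
  fix A assume "A \<in> Ob (zgroupoid C)"
  then have "A \<in> Mor (zgroupoid C)" "rng (zgroupoid C) A = A" by (auto simp: Ob_def)
  then obtain w where w: "A = zcls C w" "zpath C w" by (meson zMorE)
  then have "A = zmap C (lrng C (hd w))" using \<open>rng (zgroupoid C) A = A\<close> by (simp add: zmap_def zrng)
  then show "A \<in> zmap C ` Ob C" using w by (auto simp: Ob_def lrng_Mor rng_lrng)
qed

end


subsection \<open>Universal property over every type\<close>

lemma (in groupoid) inverse_unique:
  assumes "x \<in> Mor C" "y \<in> Mor C" "z \<in> Mor C" "src C x = rng C y" "src C z = rng C x"
    "cmp C x y = rng C x" "cmp C z x = src C x"
  shows "y = z"
  by (metis assms cmp_assoc rng_unit src_unit)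

locale groupoid_functor = category C + G: groupoid G
  for C :: "('a, 'm) cat_scheme" and G :: "('h, 'n) cat_scheme" +
  fixes F :: "'a \<Rightarrow> 'h"
  assumes F: "is_functor C G F"
begin

definition ginv :: "'h \<Rightarrow> 'h" where
  "ginv x = (SOME y. y \<in> Mor G \<and> rng G y = src G x \<and> src G y = rng G x \<and>
      cmp G x y = rng G x \<and> cmp G y x = src G x)"

lemma ginv: "x \<in> Mor G \<Longrightarrow> ginv x \<in> Mor G \<and> rng G (ginv x) = src G x \<and> src G (ginv x) = rng G x \<and>
      cmp G x (ginv x) = rng G x \<and> cmp G (ginv x) x = src G x"
  unfolding ginv_def by (rule someI_ex) (use G.inverse_ex in blast)

definition ev1 :: "'a \<times> bool \<Rightarrow> 'h" where
  "ev1 a = (if snd a then F (fst a) else ginv (F (fst a)))"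

fun ev :: "('a \<times> bool) list \<Rightarrow> 'h" where
  "ev [] = undefined"
| "ev [a] = ev1 a"
| "ev (a # b # w) = cmp G (ev1 a) (ev (b # w))"

lemma F_simps:
  "x \<in> Mor C \<Longrightarrow> F x \<in> Mor G" "x \<in> Mor C \<Longrightarrow> F (rng C x) = rng G (F x)"
  "x \<in> Mor C \<Longrightarrow> F (src C x) = src G (F x)"
  "x \<in> Mor C \<Longrightarrow> y \<in> Mor C \<Longrightarrow> src C x = rng C y \<Longrightarrow> F (cmp C x y) = cmp G (F x) (F y)"
  using F by (auto simp: is_functor_def)

lemma ev1: "fst a \<in> Mor C \<Longrightarrow>
    ev1 a \<in> Mor G \<and> rng G (ev1 a) = F (lrng C a) \<and> src G (ev1 a) = F (lsrc C a)"
  using ginv[of "F (fst a)"] by (auto simp: ev1_def lrng_def lsrc_def F_simps)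

lemma ev: "zpath C w \<Longrightarrow>
    ev w \<in> Mor G \<and> rng G (ev w) = F (lrng C (hd w)) \<and> src G (ev w) = F (lsrc C (last w))"
proof (induction w rule: ev.induct)
  case (3 a b w)
  then show ?case using ev1[of a] by (auto simp: G.cmp_Mor G.rng_cmp G.src_cmp)
qed (auto simp: ev1)

lemma ev_append: "zpath C (v @ w) \<Longrightarrow> v \<noteq> [] \<Longrightarrow> w \<noteq> [] \<Longrightarrow> ev (v @ w) = cmp G (ev v) (ev w)"
proof (induction v rule: ev.induct)
  case (2 a)
  then show ?case by (cases w) auto
next
  case (3 a b v)
  then have p: "fst a \<in> Mor C" "zpath C (b # v)" "zpath C w" "lsrc C a = lrng C b"
    "lsrc C (last (b # v)) = lrng C (hd w)"
    by (auto simp: zpath_append[of "b # v" w C, simplified])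
  then show ?case
    using 3 ev1[of a] ev[of "b # v"] ev[of w] by (simp add: G.cmp_assoc)
qed auto

lemma ev_zeq: "zeq C v w \<Longrightarrow> zpath C v \<Longrightarrow> ev v = ev w"
proof (induction rule: zeq.induct)
  case (zsym v w)
  then show ?case using zeq_zinv[of v w] by (simp add: zinv_def)
next
  case (ztrans u v w)
  then show ?case using zeq_zinv[of u v] by (simp add: zinv_def)
next
  case (zcons v w a)
  then have i: "zinv v w" "zpath C (a # w)"
    using zeq_zinv[of v w] zeq_zinv[of "a # v" "a # w"] by (auto simp: zinv_def intro: zeq.zcons)
  show ?case
  proof (cases "v = []")
    case False
    then have "w \<noteq> []" "zpath C v" using i zcons.prems by (auto simp: zinv_def neq_Nil_conv)
    then show ?thesis
      using ev_append[of "[a]" v] ev_append[of "[a]" w] zcons i False by simp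
  qed (use i in \<open>auto simp: zinv_def\<close>)
next
  case (zsnoc v w a)
  then have i: "zinv v w" "zpath C (w @ [a])"
    using zeq_zinv[of v w] zeq_zinv[of "v @ [a]" "w @ [a]"] by (auto simp: zinv_def intro: zeq.zsnoc)
  show ?case
  proof (cases "v = []")
    case False
    then have "w \<noteq> []" "zpath C v" using i zsnoc.prems by (auto simp: zinv_def zpath_append)
    then show ?thesis
      using ev_append[of v "[a]"] ev_append[of w "[a]"] zsnoc i False by simp
  qed (use i in \<open>auto simp: zinv_def\<close>)
next
  case (zlunit x)
  then show ?case using ginv[of "F x"] by (auto simp: ev1_def F_simps) (metis G.rng_unit)
next
  case (zrunit x)
  then show ?case using ginv[of "F x"] by (auto simp: ev1_def F_simps) (metis G.src_unit)
qed (use ginv in \<open>auto simp: ev1_def F_simps\<close>)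

definition zlift :: "('a \<times> bool) list set \<Rightarrow> 'h" where
  "zlift A = ev (zrep A)"

lemma zlift: "zpath C w \<Longrightarrow> zlift (zcls C w) = ev w"
  unfolding zlift_def using ev_zeq[OF zeq_zrep[of C w]] by simp

lemma is_functor_zlift: "is_functor (zgroupoid C) G zlift"
  unfolding is_functor_def
proof (intro conjI ballI impI)
  fix A assume "A \<in> Mor (zgroupoid C)"
  then obtain w where w: "A = zcls C w" "zpath C w" by (rule zMorE)
  then show "zlift A \<in> Mor G" "zlift (rng (zgroupoid C) A) = rng G (zlift A)"
    "zlift (src (zgroupoid C) A) = src G (zlift A)"
    using ev[of w] by (auto simp: zlift zrng zsrc lrng_Mor lsrc_Mor ev1_def)
next
  fix A B assume AB: "A \<in> Mor (zgroupoid C)" "B \<in> Mor (zgroupoid C)"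
    and c: "src (zgroupoid C) A = rng (zgroupoid C) B"
  from AB obtain v w where vw: "A = zcls C v" "zpath C v" "B = zcls C w" "zpath C w"
    by (meson zMorE)
  have "zpath C (v @ w)" using vw c by (auto simp: zpath_append zpath_nonempty zsrc_eq_zrng)
  then show "zlift (cmp (zgroupoid C) A B) = cmp G (zlift A) (zlift B)"
    using vw by (simp add: zcomp zlift ev_append zpath_nonempty)
qed

lemma zlift_zmap: "x \<in> Mor C \<Longrightarrow> zlift (zmap C x) = F x"
  by (simp add: zmap_def zlift ev1_def)

lemma zlift_unique:
  assumes H: "is_functor (zgroupoid C) G H" and HF: "\<And>x. x \<in> Mor C \<Longrightarrow> H (zmap C x) = F x"
    and A: "A \<in> Mor (zgroupoid C)"
  shows "H A = zlift A"
proof -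
  have H1: "H (zcls C [a]) = ev1 a" if a: "fst a \<in> Mor C" for a
  proof (cases "snd a")
    case True
    then show ?thesis using HF[OF a] by (cases a) (simp add: ev1_def zmap_def)
  next
    case False
    then obtain x where ax: "a = (x, False)" by (cases a) auto
    with a have x: "x \<in> Mor C" by simp
    have p: "zcls C [(x, True)] \<in> Mor (zgroupoid C)" "zcls C [(x, False)] \<in> Mor (zgroupoid C)"
      using x by auto
    have c: "src (zgroupoid C) (zcls C [(x, True)]) = rng (zgroupoid C) (zcls C [(x, False)])"
      "src (zgroupoid C) (zcls C [(x, False)]) = rng (zgroupoid C) (zcls C [(x, True)])"
      using x by (auto simp: zsrc_eq_zrng lrng_def lsrc_def)
    let ?y = "H (zcls C [(x, False)])"
    have Hx: "H (zcls C [(x, True)]) = F x" using HF[OF x] by (simp add: zmap_def)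
    have y: "?y \<in> Mor G" "rng G ?y = src G (F x)" "src G ?y = rng G (F x)"
    proof -
      have h: "H A \<in> Mor G" "H (rng (zgroupoid C) A) = rng G (H A)"
        "H (src (zgroupoid C) A) = src G (H A)" if "A \<in> Mor (zgroupoid C)" for A
        using H that by (auto simp: is_functor_def)
      show "?y \<in> Mor G" by (rule h(1)[OF p(2)])
      show "rng G ?y = src G (F x)" by (simp only: h(2)[OF p(2), symmetric] h(3)[OF p(1), symmetric] c flip: Hx)
      show "src G ?y = rng G (F x)" by (simp only: h(3)[OF p(2), symmetric] h(2)[OF p(1), symmetric] c flip: Hx)
    qed
    have "cmp G (F x) ?y = H (zcls C [(x, True), (x, False)])"
      using H[unfolded is_functor_def, THEN conjunct2, rule_format, OF p(1) p(2) c(1)]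
      by (simp add: Hx zcomp)
    also have "\<dots> = H (zmap C (rng C x))"
      using zcls_eq_iff[THEN iffD2, OF zrinv[OF x]] by (simp add: zmap_def)
    finally have "cmp G (F x) ?y = rng G (F x)" using x by (simp add: HF rng_Mor F_simps)
    then have "?y = ginv (F x)"
      using y ginv[OF F_simps(1)[OF x]] F_simps(1)[OF x]
      by - (rule G.inverse_unique[of "F x"]; simp)
    then show ?thesis by (simp add: ax ev1_def)
  qed
  obtain w where w: "A = zcls C w" "zpath C w" using A by (rule zMorE)
  have "zpath C w \<Longrightarrow> H (zcls C w) = ev w" for w
  proof (induction w rule: ev.induct)
    case (3 a b w)
    then have "H (cmp (zgroupoid C) (zcls C [a]) (zcls C (b # w))) =
        cmp G (H (zcls C [a])) (H (zcls C (b # w)))"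
      using H unfolding is_functor_def by (auto simp: zsrc_eq_zrng)
    then show ?case using 3 H1[of a] by (simp add: zcomp)
  qed (auto simp: H1)
  with w show ?thesis by (simp add: zlift)
qed

end

lemma zgroupoid_universal:
  assumes "category C" shows "universal_to TYPE('h) C (zgroupoid C) (zmap C)"
  unfolding universal_to_def
proof (intro allI impI)
  fix G :: "'h cat" and F assume "groupoid G \<and> is_functor C G F"
  then interpret groupoid_functor C G F
    using assms by (simp add: groupoid_functor_def groupoid_functor_axioms_def)
  show "\<exists>F'. is_functor (zgroupoid C) G F' \<and> (\<forall>x\<in>Mor C. F' (zmap C x) = F x) \<and>
      (\<forall>F''. is_functor (zgroupoid C) G F'' \<and> (\<forall>x\<in>Mor C. F'' (zmap C x) = F x) \<longrightarrow>
        (\<forall>p\<in>Mor (zgroupoid C). F'' p = F' p))"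
    using is_functor_zlift zlift_zmap zlift_unique by blast
qed

theorem fundamental_groupoid_exists:
  "category C \<Longrightarrow> fundamental_groupoid C (zgroupoid C) (zmap C)"
  by (simp add: fundamental_groupoid_def zgroupoid_universal category.groupoid_zgroupoid
      category.is_functor_zmap category.zmap_Ob)

lemma is_functor_comp: "is_functor A B F \<Longrightarrow> is_functor B D H \<Longrightarrow> is_functor A D (H \<circ> F)"
  by (simp add: is_functor_def) metis

lemma is_functor_id: "category A \<Longrightarrow> is_functor A A (\<lambda>x. x)"
  by (auto simp: is_functor_def category.rng_Mor category.src_Mor)

lemma universal_toE:
  fixes G :: "'h cat"
  assumes "universal_to TYPE('h) C P i" "groupoid G" "is_functor C G F"
  obtains F' where "is_functor P G F'" "\<forall>x\<in>Mor C. F' (i x) = F x"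
    "\<And>F''. is_functor P G F'' \<Longrightarrow> \<forall>x\<in>Mor C. F'' (i x) = F x \<Longrightarrow> \<forall>p\<in>Mor P. F'' p = F' p"
proof -
  from assms(1)[unfolded universal_to_def, rule_format, OF conjI, OF assms(2,3)]
  show ?thesis using that by blast
qed

theorem fundamental_groupoid_universal:
  fixes C :: "('a, 'm) cat_scheme" and P :: "'p cat"
  assumes "category C" "fundamental_groupoid C P i"
  shows "universal_to TYPE('h) C P i"
proof -
  have P: "groupoid P" "is_functor C P i" "universal_to TYPE('p) C P i"
    "universal_to TYPE(('a \<times> bool) list set) C P i"
    using assms(2) by (simp_all add: fundamental_groupoid_def)
  let ?Z = "zgroupoid C"
  have Z: "groupoid ?Z" "is_functor C ?Z (zmap C)"
    using assms(1) by (simp_all add: category.groupoid_zgroupoid category.is_functor_zmap)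
  obtain f where f: "is_functor P ?Z f" "\<forall>x\<in>Mor C. f (i x) = zmap C x"
    using universal_toE[OF P(4) Z] by metis
  obtain g where g: "is_functor ?Z P g" "\<forall>x\<in>Mor C. g (zmap C x) = i x"
    using universal_toE[OF zgroupoid_universal[OF assms(1)] P(1,2)] by metis
  obtain h where h: "\<And>e. is_functor P P e \<Longrightarrow> \<forall>x\<in>Mor C. e (i x) = i x \<Longrightarrow> \<forall>p\<in>Mor P. e p = h p"
    using universal_toE[OF P(3) P(1,2)] by metis
  have "\<forall>p\<in>Mor P. (g \<circ> f) p = h p"
    by (rule h[OF is_functor_comp[OF f(1) g(1)]]) (simp add: f g)
  moreover have "\<forall>p\<in>Mor P. p = h p"
    using h[OF is_functor_id] P(1) by (simp add: groupoid_def)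
  ultimately have gf: "\<forall>p\<in>Mor P. g (f p) = p" by simp
  show ?thesis
    unfolding universal_to_def
  proof (intro allI impI)
    fix G :: "'h cat" and F assume GF: "groupoid G \<and> is_functor C G F"
    obtain k where k: "is_functor ?Z G k" "\<forall>x\<in>Mor C. k (zmap C x) = F x"
      and ku: "\<And>e. is_functor ?Z G e \<Longrightarrow> \<forall>x\<in>Mor C. e (zmap C x) = F x \<Longrightarrow> \<forall>p\<in>Mor ?Z. e p = k p"
      proof (rule universal_toE[OF zgroupoid_universal[OF assms(1)] GF[THEN conjunct1]
          GF[THEN conjunct2]])
    qed (rule that)
    have 1: "is_functor P G (k \<circ> f)" by (rule is_functor_comp[OF f(1) k(1)])
    have 2: "\<forall>x\<in>Mor C. (k \<circ> f) (i x) = F x" using f k by simp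
    have 3: "\<forall>p\<in>Mor P. e p = (k \<circ> f) p"
      if e: "is_functor P G e" "\<forall>x\<in>Mor C. e (i x) = F x" for e
    proof
      fix p assume p: "p \<in> Mor P"
      have "\<forall>q\<in>Mor ?Z. (e \<circ> g) q = k q"
        by (rule ku[OF is_functor_comp[OF g(1) e(1)]]) (simp add: e g)
      moreover have "f p \<in> Mor ?Z" using f(1) p by (simp add: is_functor_def)
      ultimately have "e (g (f p)) = k (f p)" by simp
      then show "e p = (k \<circ> f) p" using gf p by simp
    qed
    show "\<exists>F'. is_functor P G F' \<and> (\<forall>x\<in>Mor C. F' (i x) = F x) \<and>
        (\<forall>F''. is_functor P G F'' \<and> (\<forall>x\<in>Mor C. F'' (i x) = F x) \<longrightarrow> (\<forall>p\<in>Mor P. F'' p = F' p))"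
    proof (rule exI[of _ "k \<circ> f"], intro conjI allI impI)
      show "\<forall>p\<in>Mor P. e p = (k \<circ> f) p"
        if "is_functor P G e \<and> (\<forall>x\<in>Mor C. e (i x) = F x)" for e
        using that by (elim conjE) (rule 3)
    qed (rule 1, rule 2)
  qed
qed

end

theory Submission
  imports Defs Complex_Main
begin

text \<open>
  Two functors from \<open>\<Gamma>\<close> to groupoids together separate its morphisms. The free monoid embeds into
  the group of affine maps of the line, a word acting as the base \<open>n + 2\<close> expansion with
  its letters as digits, and projecting \<open>\<Gamma>\<close> to \<open>B\<^sub>n\<close> then recovers \<open>\<mu>\<close> from
  \<open>i\<^sub>\<Gamma>(\<mu>, \<lambda>)\<close>. By the universal property \<open>Aut(\<Lambda>)\<close> acts on \<open>\<Pi>(\<Lambda>)\<close>, and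
  \<open>(\<mu>, \<lambda>) \<mapsto> (\<alpha>\<^sub>\<mu>, i\<^sub>\<Lambda>(\<lambda>))\<close> is a functor to the semidirect product groupoid, which recovers
  \<open>\<lambda>\<close>.
\<close>

section \<open>Crossed products of categories by monoid actions\<close>

lemma is_functorD:
  assumes "is_functor C D F" "x \<in> Mor C"
  shows "F x \<in> Mor D" "F (rng C x) = rng D (F x)" "F (src C x) = src D (F x)"
    and "y \<in> Mor C \<Longrightarrow> src C x = rng C y \<Longrightarrow> F (cmp C x y) = cmp D (F x) (F y)"
  using assms by (auto simp: is_functor_def)

text \<open>The pair \<open>(g, x)\<close> stands for a formal product \<open>g x\<close>, in which
  the two kinds of factor move past each other by \<open>(\<phi> h x) h = h x\<close>. One formula
  serves both for \<open>Gam\<close>, with words as \<open>M\<close>, and for the semidirect product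
  groupoid, with a group as \<open>M\<close>.\<close>

definition crossed ::
  "('g, 'k) monoid_scheme \<Rightarrow> ('a, 'm) cat_scheme \<Rightarrow> ('g \<Rightarrow> 'a \<Rightarrow> 'a) \<Rightarrow> ('g \<times> 'a) cat" where
  "crossed M C \<phi> =
     \<lparr>Mor = carrier M \<times> Mor C,
      rng = (\<lambda>(g, x). (\<one>\<^bsub>M\<^esub>, \<phi> g (rng C x))),
      src = (\<lambda>(g, x). (\<one>\<^bsub>M\<^esub>, src C x)),
      cmp = (\<lambda>(g, y) (h, z). (g \<otimes>\<^bsub>M\<^esub> h, cmp C (inv_into (Mor C) (\<phi> h) y) z))\<rparr>"

text \<open>Bijectivity is a separate axiom because \<open>M\<close> need not be a group: words act
  invertibly without being invertible.\<close>

locale category_action = category C + M: monoid M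
  for C :: "('a, 'm) cat_scheme" and M :: "('g, 'k) monoid_scheme" +
  fixes \<phi> :: "'g \<Rightarrow> 'a \<Rightarrow> 'a"
  assumes act_functor: "g \<in> carrier M \<Longrightarrow> is_functor C C (\<phi> g)"
    and act_bij: "g \<in> carrier M \<Longrightarrow> bij_betw (\<phi> g) (Mor C) (Mor C)"
    and act_one: "x \<in> Mor C \<Longrightarrow> \<phi> \<one>\<^bsub>M\<^esub> x = x"
    and act_mult: "\<lbrakk>g \<in> carrier M; h \<in> carrier M; x \<in> Mor C\<rbrakk> \<Longrightarrow> \<phi> (g \<otimes>\<^bsub>M\<^esub> h) x = \<phi> g (\<phi> h x)"
begin

definition \<psi> :: "'g \<Rightarrow> 'a \<Rightarrow> 'a" where
  "\<psi> g = inv_into (Mor C) (\<phi> g)"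

lemmas act = is_functorD[OF act_functor]

lemma act_inverse:
  assumes "g \<in> carrier M" "x \<in> Mor C"
  shows "\<psi> g x \<in> Mor C" "\<phi> g (\<psi> g x) = x" "\<psi> g (\<phi> g x) = x"
  using assms act_bij[of g]
  by (auto simp: \<psi>_def bij_betw_def inv_into_f_f f_inv_into_f intro: inv_into_into)

lemma act_cancel:
  "\<lbrakk>g \<in> carrier M; x \<in> Mor C; y \<in> Mor C; \<phi> g x = \<phi> g y\<rbrakk> \<Longrightarrow> x = y"
  by (metis act_inverse(3))

lemma inverse_act:
  assumes "g \<in> carrier M" "x \<in> Mor C"
  shows "rng C (\<psi> g x) = \<psi> g (rng C x)" "src C (\<psi> g x) = \<psi> g (src C x)"
  by (rule act_cancel[OF assms(1)]; simp add: assms act act_inverse rng_Mor src_Mor)+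

lemma inverse_act_cmp:
  assumes "g \<in> carrier M" "x \<in> Mor C" "y \<in> Mor C" "src C x = rng C y"
  shows "\<psi> g (cmp C x y) = cmp C (\<psi> g x) (\<psi> g y)"
  by (rule act_cancel[OF assms(1)])
     (simp_all add: assms act act_inverse inverse_act cmp_Mor rng_Mor)

lemma inverse_act_one: "x \<in> Mor C \<Longrightarrow> \<psi> \<one>\<^bsub>M\<^esub> x = x"
  by (metis act_inverse(3) act_one M.one_closed)

lemma inverse_act_mult:
  assumes "g \<in> carrier M" "h \<in> carrier M" "x \<in> Mor C"
  shows "\<psi> (g \<otimes>\<^bsub>M\<^esub> h) x = \<psi> h (\<psi> g x)"
  by (rule act_cancel[of "g \<otimes>\<^bsub>M\<^esub> h"]) (simp_all add: assms act_inverse act_mult)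

text \<open>By this, two pairs are composable in \<open>crossed\<close> exactly when the product
  formed there in \<open>C\<close> is composable.\<close>

lemma src_eq_rng_inverse:
  assumes "g \<in> carrier M" "x \<in> Mor C" "y \<in> Mor C"
  shows "src C x = \<phi> g (rng C y) \<longleftrightarrow> src C (\<psi> g x) = rng C y"
  using assms by (metis act_inverse(2,3) inverse_act(2) rng_Mor src_Mor)

text \<open>Associativity rests on \<open>\<psi> h\<close> being a functor and on
  \<open>\<psi>\<close> reversing products: for \<open>(f, x)\<close>, \<open>(g, y)\<close>,
  \<open>(h, z)\<close> either bracketing composes \<open>\<psi> h (\<psi> g x)\<close>,
  \<open>\<psi> h y\<close> and \<open>z\<close> in the second component.\<close>

lemma category_crossed: "category (crossed M C \<phi>)"
proof
  fix a b c
  assume "a \<in> Mor (crossed M C \<phi>)" "b \<in> Mor (crossed M C \<phi>)" "c \<in> Mor (crossed M C \<phi>)"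
    "src (crossed M C \<phi>) a = rng (crossed M C \<phi>) b" "src (crossed M C \<phi>) b = rng (crossed M C \<phi>) c"
  then show "cmp (crossed M C \<phi>) (cmp (crossed M C \<phi>) a b) c =
      cmp (crossed M C \<phi>) a (cmp (crossed M C \<phi>) b c)"
    by (auto simp: crossed_def \<psi>_def[symmetric] src_eq_rng_inverse inverse_act_mult M.m_assoc
        inverse_act_cmp inverse_act act_inverse cmp_assoc rng_Mor src_Mor)
next
  fix a b
  assume "a \<in> Mor (crossed M C \<phi>)" "b \<in> Mor (crossed M C \<phi>)"
    and "src (crossed M C \<phi>) a = rng (crossed M C \<phi>) b"
  then obtain g x h y where a: "a = (g, x)" "b = (h, y)" "g \<in> carrier M" "x \<in> Mor C"
    "h \<in> carrier M" "y \<in> Mor C" "src C (\<psi> h x) = rng C y"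
    by (auto simp: crossed_def src_eq_rng_inverse)
  then show "cmp (crossed M C \<phi>) a b \<in> Mor (crossed M C \<phi>)"
    "src (crossed M C \<phi>) (cmp (crossed M C \<phi>) a b) = src (crossed M C \<phi>) b"
    "rng (crossed M C \<phi>) (cmp (crossed M C \<phi>) a b) = rng (crossed M C \<phi>) a"
    by (simp_all add: crossed_def \<psi>_def[symmetric] act_inverse cmp_Mor src_cmp rng_cmp act_mult
        inverse_act rng_Mor)
qed (auto simp: crossed_def \<psi>_def[symmetric] act(1) act_one act_inverse inverse_act_one rng_Mor
    src_Mor rng_rng src_src rng_src src_rng rng_unit src_unit simp flip: act(2,3))

end

text \<open>With \<open>y\<close> inverse to \<open>x\<close>, the inverse of the product
  \<open>g x\<close> is \<open>y\<close> times the inverse of \<open>g\<close>; the commutation rule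
  moves that inverse to the front and turns \<open>y\<close> into \<open>\<phi> g y\<close>.\<close>

lemma (in category_action) groupoid_crossed:
  assumes "groupoid C" "group M"
  shows "groupoid (crossed M C \<phi>)"
proof -
  interpret C: groupoid C by fact
  interpret M: group M by fact
  have cancel: "\<phi> (inv\<^bsub>M\<^esub> g) (\<phi> g x) = x" if "g \<in> carrier M" "x \<in> Mor C" for g x
    using that act_mult[of "inv\<^bsub>M\<^esub> g" g x] act_one by simp
  have inv: "\<psi> (inv\<^bsub>M\<^esub> g) x = \<phi> g x" if "g \<in> carrier M" "x \<in> Mor C" for g x
    by (rule act_cancel[of "inv\<^bsub>M\<^esub> g"]) (simp_all add: that act(1) act_inverse cancel)
  have "\<exists>b \<in> Mor (crossed M C \<phi>). rng (crossed M C \<phi>) b = src (crossed M C \<phi>) a \<and>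
      src (crossed M C \<phi>) b = rng (crossed M C \<phi>) a \<and>
      cmp (crossed M C \<phi>) a b = rng (crossed M C \<phi>) a \<and>
      cmp (crossed M C \<phi>) b a = src (crossed M C \<phi>) a"
    if "a \<in> Mor (crossed M C \<phi>)" for a
  proof -
    from that obtain g x where a: "a = (g, x)" "g \<in> carrier M" "x \<in> Mor C"
      by (auto simp: crossed_def)
    obtain y where y: "y \<in> Mor C" "rng C y = src C x" "src C y = rng C x"
      "cmp C x y = rng C x" "cmp C y x = src C x"
      using C.inverse_ex a by blast
    have "\<phi> (inv\<^bsub>M\<^esub> g) (rng C (\<phi> g y)) = src C x"
      using a y cancel[of g "src C x"] act(2)[of g y] by (simp add: src_Mor)
    moreover have "src C (\<phi> g y) = \<phi> g (rng C x)"
      using act(3)[OF a(2) y(1)] y(3) by simp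
    moreover have "cmp C (\<phi> g x) (\<phi> g y) = \<phi> g (rng C x)"
      using a y act(4)[of g x y] by simp
    ultimately show ?thesis
      using a y(1,5)
      by (intro bexI[of _ "(inv\<^bsub>M\<^esub> g, \<phi> g y)"])
         (simp_all add: crossed_def inv act(1) act_inverse(3) flip: \<psi>_def)
  qed
  then show ?thesis
    using category_crossed by (simp add: groupoid_def groupoid_axioms_def)
qed

section \<open>The crossed product graph\<close>

text \<open>The locale \<open>category\<close> reads only the four fields of \<open>cat\<close>, so
  what holds for \<open>crossed\<close> transfers to \<open>Gam\<close>, which carries
  \<open>deg\<close> in addition.\<close>

lemma category_truncate_iff: "category (cat.truncate C) \<longleftrightarrow> category C"
  by (simp add: category_def cat.truncate_def)

lemma Aut_carrierD:
  assumes "f \<in> carrier (Aut L)"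
  shows "is_functor L L f" "bij_betw f (Mor L) (Mor L)" "x \<in> Mor L \<Longrightarrow> deg L (f x) = deg L x"
  using assms by (auto simp: Aut_def Bij_def)

lemma Aut_one: "x \<in> Mor L \<Longrightarrow> \<one>\<^bsub>Aut L\<^esub> x = x"
  by (simp add: Aut_def BijGroup_def)

lemma Aut_mult:
  "f \<in> carrier (Aut L) \<Longrightarrow> g \<in> carrier (Aut L) \<Longrightarrow> x \<in> Mor L \<Longrightarrow> (f \<otimes>\<^bsub>Aut L\<^esub> g) x = f (g x)"
  by (simp add: Aut_def BijGroup_def compose_def)

definition word_monoid :: "nat \<Rightarrow> nat list monoid" where
  "word_monoid n = \<lparr>carrier = lists {..<n}, mult = (@), one = []\<rparr>"

lemma monoid_word_monoid: "monoid (word_monoid n)"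
  by unfold_locales (auto simp: word_monoid_def)

context k_graph
begin

lemma deg_simps:
  assumes "x \<in> Mor L"
  shows "deg L x \<in> carrier (degree_monoid k)"
    and "deg L (rng L x) = (\<lambda>_. 0)" "deg L (src L x) = (\<lambda>_. 0)"
    and "y \<in> Mor L \<Longrightarrow> src L x = rng L y \<Longrightarrow> deg L (cmp L x y) = (\<lambda>i. deg L x i + deg L y i)"
  using is_functorD[OF deg_functor assms] by (simp_all add: one_object_def degree_monoid_def)

text \<open>Both pairs factor the same morphism in the degrees of \<open>y\<close> and
  \<open>z\<close>, so the uniqueness in \<open>factorisation\<close> identifies them.\<close>

lemma factorisation_unique:
  assumes "y \<in> Mor L" "z \<in> Mor L" "src L y = rng L z"
    and "y' \<in> Mor L" "z' \<in> Mor L" "src L y' = rng L z'"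
    and "cmp L y z = cmp L y' z'" "deg L y = deg L y'" "deg L z = deg L z'"
  shows "y = y' \<and> z = z'"
proof -
  define R where "R = (\<lambda>(u, v). u \<in> Mor L \<and> v \<in> Mor L \<and> src L u = rng L v \<and>
    deg L u = deg L y \<and> deg L v = deg L z \<and> cmp L y z = cmp L u v)"
  have "\<exists>!q. R q"
    unfolding R_def using assms
    by (intro factorisation cmp_Mor deg_simps(1)) (simp_all add: deg_simps degree_monoid_def)
  moreover have "R (y, z)" "R (y', z')" using assms by (simp_all add: R_def)
  ultimately show ?thesis by blast
qed

end

locale word_action = k_graph k L for k and L :: "('a, 'm) kgraph_scheme" +
  fixes n :: nat and \<alpha> :: "nat list \<Rightarrow> 'a \<Rightarrow> 'a"
  assumes \<alpha>: "is_functor (Bn n) (one_object (Aut L)) \<alpha>"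
begin

lemma \<alpha>_simps:
  "\<mu> \<in> lists {..<n} \<Longrightarrow> \<alpha> \<mu> \<in> carrier (Aut L)"
  "\<alpha> [] = \<one>\<^bsub>Aut L\<^esub>"
  "\<mu> \<in> lists {..<n} \<Longrightarrow> \<nu> \<in> lists {..<n} \<Longrightarrow> \<alpha> (\<mu> @ \<nu>) = \<alpha> \<mu> \<otimes>\<^bsub>Aut L\<^esub> \<alpha> \<nu>"
  using \<alpha> by (auto simp: is_functor_def one_object_def Bn_def)

sublocale A: category_action L "word_monoid n" \<alpha>
proof (intro category_action.intro category_action_axioms.intro)
  show "category L" by (rule category_axioms)
qed (simp_all add: monoid_word_monoid, simp_all add: word_monoid_def \<alpha>_simps Aut_carrierD
    Aut_one Aut_mult)

lemma truncate_Gam: "cat.truncate (Gam n L \<alpha>) = crossed (word_monoid n) L \<alpha>"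
  by (simp add: cat.truncate_def Gam_def crossed_def word_monoid_def Bn_def)

lemma category_Gam: "category (Gam n L \<alpha>)"
  using A.category_crossed category_truncate_iff[of "Gam n L \<alpha>"] by (simp add: truncate_Gam)

lemma Gam_simps:
  "Mor (Gam n L \<alpha>) = lists {..<n} \<times> Mor L"
  "rng (Gam n L \<alpha>) (\<mu>, x) = ([], \<alpha> \<mu> (rng L x))"
  "src (Gam n L \<alpha>) (\<mu>, x) = ([], src L x)"
  "cmp (Gam n L \<alpha>) (\<mu>, y) (\<nu>, z) = (\<mu> @ \<nu>, cmp L (A.\<psi> \<nu> y) z)"
  "deg (Gam n L \<alpha>) (\<mu>, x) = case_nat (length \<mu>) (deg L x)"
  by (simp_all add: Gam_def Bn_def A.\<psi>_def)

lemma act_facts: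
  assumes "\<mu> \<in> lists {..<n}" "x \<in> Mor L"
  shows "\<alpha> \<mu> x \<in> Mor L" "A.\<psi> \<mu> x \<in> Mor L" "\<alpha> \<mu> (A.\<psi> \<mu> x) = x" "A.\<psi> \<mu> (\<alpha> \<mu> x) = x"
    "deg L (\<alpha> \<mu> x) = deg L x" "deg L (A.\<psi> \<mu> x) = deg L x"
    "src L (\<alpha> \<mu> x) = \<alpha> \<mu> (src L x)"
proof -
  have \<mu>: "\<mu> \<in> carrier (word_monoid n)" using assms by (simp add: word_monoid_def)
  note d = Aut_carrierD(3)[OF \<alpha>_simps(1)[OF assms(1)]]
  show "\<alpha> \<mu> x \<in> Mor L" "A.\<psi> \<mu> x \<in> Mor L" "\<alpha> \<mu> (A.\<psi> \<mu> x) = x" "A.\<psi> \<mu> (\<alpha> \<mu> x) = x"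
    "src L (\<alpha> \<mu> x) = \<alpha> \<mu> (src L x)"
    using A.act[OF \<mu> assms(2)] A.act_inverse[OF \<mu> assms(2)] by auto
  then show "deg L (\<alpha> \<mu> x) = deg L x" "deg L (A.\<psi> \<mu> x) = deg L x"
    using d[of x] d[of "A.\<psi> \<mu> x"] assms by auto
qed

lemma composable_iff:
  assumes "\<nu> \<in> lists {..<n}" "x \<in> Mor L" "y \<in> Mor L"
  shows "src L x = \<alpha> \<nu> (rng L y) \<longleftrightarrow> src L (A.\<psi> \<nu> x) = rng L y"
  using assms by (intro A.src_eq_rng_inverse) (simp_all add: word_monoid_def)

text \<open>Lengths determine how the word splits, and degrees how the morphism of \<open>L\<close>
  splits. The twist by \<open>\<alpha>\<close> is compatible with this because automorphisms
  preserve degrees.\<close>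

lemma k_graph_Gam: "k_graph (k + 1) (Gam n L \<alpha>)"
proof (intro k_graph.intro k_graph_axioms.intro category_Gam)
  show "is_functor (Gam n L \<alpha>) (one_object (degree_monoid (k + 1))) (deg (Gam n L \<alpha>))"
    unfolding is_functor_def
  proof (intro conjI ballI impI)
    fix a assume "a \<in> Mor (Gam n L \<alpha>)"
    then obtain \<mu> x where "a = (\<mu>, x)" "\<mu> \<in> lists {..<n}" "x \<in> Mor L"
      by (auto simp: Gam_simps)
    then show "deg (Gam n L \<alpha>) a \<in> Mor (one_object (degree_monoid (k + 1)))"
      "deg (Gam n L \<alpha>) (rng (Gam n L \<alpha>) a) =
        rng (one_object (degree_monoid (k + 1))) (deg (Gam n L \<alpha>) a)"
      "deg (Gam n L \<alpha>) (src (Gam n L \<alpha>) a) =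
        src (one_object (degree_monoid (k + 1))) (deg (Gam n L \<alpha>) a)"
      using deg_simps(1)[of x]
      by (auto simp: one_object_def degree_monoid_def Gam_simps act_facts deg_simps
          rng_Mor split: nat.split)
  next
    fix a b assume "a \<in> Mor (Gam n L \<alpha>)" "b \<in> Mor (Gam n L \<alpha>)"
      "src (Gam n L \<alpha>) a = rng (Gam n L \<alpha>) b"
    then obtain \<mu> x \<nu> y where ab: "a = (\<mu>, x)" "b = (\<nu>, y)"
      "\<mu> \<in> lists {..<n}" "\<nu> \<in> lists {..<n}" "x \<in> Mor L" "y \<in> Mor L"
      "src L x = \<alpha> \<nu> (rng L y)"
      by (cases a; cases b) (auto simp only: Gam_simps mem_Sigma_iff prod.inject)
    have "src L (A.\<psi> \<nu> x) = rng L y"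
      using ab(7) composable_iff[OF ab(4,5,6)] by blast
    with ab(1-6) show "deg (Gam n L \<alpha>) (cmp (Gam n L \<alpha>) a b) =
        cmp (one_object (degree_monoid (k + 1))) (deg (Gam n L \<alpha>) a) (deg (Gam n L \<alpha>) b)"
      by (simp add: one_object_def degree_monoid_def Gam_simps act_facts(2,6) deg_simps
          fun_eq_iff split: nat.split)
  qed
next
  fix a m m'
  assume a: "a \<in> Mor (Gam n L \<alpha>)"
    and m: "m \<in> carrier (degree_monoid (k + 1))" "m' \<in> carrier (degree_monoid (k + 1))"
    and d: "deg (Gam n L \<alpha>) a = m \<otimes>\<^bsub>degree_monoid (k + 1)\<^esub> m'"
  obtain \<mu> x where x: "a = (\<mu>, x)" "\<mu> \<in> lists {..<n}" "x \<in> Mor L"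
    using a by (auto simp: Gam_simps)
  \<comment> \<open>Coordinate 0 is the word length; the remaining \<open>k\<close> coordinates,
    shifted down, are degrees in \<open>L\<close>.\<close>
  define p p' where "p = (\<lambda>i. m (Suc i))" and "p' = (\<lambda>i. m' (Suc i))"
  have p: "p \<in> carrier (degree_monoid k)" "p' \<in> carrier (degree_monoid k)"
    using m by (auto simp: p_def p'_def degree_monoid_def)
  have deg_eq: "case_nat l e = m \<longleftrightarrow> l = m 0 \<and> e = p"
    "case_nat l e = m' \<longleftrightarrow> l = m' 0 \<and> e = p'" for l e
    by (auto simp: p_def p'_def fun_eq_iff split: nat.split)
  have len: "length \<mu> = m 0 + m' 0"
    using fun_cong[OF d, of 0] x by (simp add: Gam_simps degree_monoid_def)
  have "deg L x i = p i + p' i" for i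
    using fun_cong[OF d, of "Suc i"] x by (simp add: Gam_simps degree_monoid_def p_def p'_def)
  then have dx: "deg L x = p \<otimes>\<^bsub>degree_monoid k\<^esub> p'"
    by (simp add: degree_monoid_def fun_eq_iff)
  define \<mu>1 \<mu>2 where "\<mu>1 = take (m 0) \<mu>" and "\<mu>2 = drop (m 0) \<mu>"
  have \<mu>: "\<mu>1 \<in> lists {..<n}" "\<mu>2 \<in> lists {..<n}" "\<mu>1 @ \<mu>2 = \<mu>" "length \<mu>1 = m 0" "length \<mu>2 = m' 0"
    using x(2) len by (auto simp: \<mu>1_def \<mu>2_def in_lists_conv_set dest: in_set_takeD in_set_dropD)
  obtain y z where yz: "y \<in> Mor L" "z \<in> Mor L" "src L y = rng L z"
      "deg L y = p" "deg L z = p'" "x = cmp L y z"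
    using factorisation[OF x(3) p dx] by blast
  show "\<exists>!(b, c). b \<in> Mor (Gam n L \<alpha>) \<and> c \<in> Mor (Gam n L \<alpha>) \<and>
      src (Gam n L \<alpha>) b = rng (Gam n L \<alpha>) c \<and> deg (Gam n L \<alpha>) b = m \<and>
      deg (Gam n L \<alpha>) c = m' \<and> a = cmp (Gam n L \<alpha>) b c"
  \<comment> \<open>Composition applies \<open>A.\<psi> \<mu>2\<close> to the left factor, so
    \<open>y\<close> is twisted by \<open>\<alpha> \<mu>2\<close> beforehand.\<close>
  proof (rule ex1I[of _ "((\<mu>1, \<alpha> \<mu>2 y), (\<mu>2, z))"], goal_cases)
    case 1
    show ?case using yz \<mu> x by (simp add: Gam_simps act_facts deg_eq)
  next
    case (2 bc)
    obtain \<nu> y' \<nu>' z' where split: "bc = ((\<nu>, y'), (\<nu>', z'))"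
      by (metis surj_pair)
    with 2 x have bc: "\<nu> \<in> lists {..<n}" "\<nu>' \<in> lists {..<n}" "y' \<in> Mor L" "z' \<in> Mor L"
      "src L y' = \<alpha> \<nu>' (rng L z')" "length \<nu> = m 0" "deg L y' = p" "deg L z' = p'"
      "\<mu> = \<nu> @ \<nu>'" "x = cmp L (A.\<psi> \<nu>' y') z'"
      by (simp_all only: prod.case Gam_simps deg_eq mem_Sigma_iff prod.inject)
    have "\<nu> = \<mu>1 \<and> \<nu>' = \<mu>2"
      using bc(6,9) \<mu>(3,4) by (intro append_eq_append_conv[THEN iffD1]) auto
    moreover have "src L (A.\<psi> \<nu>' y') = rng L z'"
      using composable_iff[OF bc(2,3,4)] bc(5) by blast
    \<comment> \<open>Uniqueness in \<open>L\<close> concerns the untwisted left factor; applying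
      \<open>\<alpha> \<nu>'\<close> afterwards recovers \<open>y'\<close>.\<close>
    then have "A.\<psi> \<nu>' y' = y \<and> z' = z"
      by (rule factorisation_unique[OF act_facts(2)[OF bc(2,3)] bc(4) _ yz(1-3)])
         (simp_all only: bc(7,8) yz(4,5) act_facts(6)[OF bc(2,3)] flip: bc(10) yz(6))
    ultimately show ?case using split act_facts(3)[OF bc(2,3)] by simp
  qed
qed

end

section \<open>Separating the morphisms\<close>

lemma groupoid_one_object:
  assumes "group M"
  shows "groupoid (one_object M)"
proof -
  interpret group M by fact
  interpret category "one_object M" by (rule category_one_object) (rule monoid_axioms)
  show ?thesis
  proof
    fix x assume "x \<in> Mor (one_object M)"
    then show "\<exists>y\<in>Mor (one_object M). rng (one_object M) y = src (one_object M) x \<and>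
        src (one_object M) y = rng (one_object M) x \<and>
        cmp (one_object M) x y = rng (one_object M) x \<and>
        cmp (one_object M) y x = src (one_object M) x"
      by (intro bexI[of _ "inv\<^bsub>M\<^esub> x"]) (simp_all add: one_object_def)
  qed
qed

text \<open>The pair \<open>(a, b)\<close> stands for the affine map \<open>x \<mapsto> a x + b\<close>.\<close>

definition affine_group :: "(real \<times> real) monoid" where
  "affine_group = \<lparr>carrier = {(a, b). a \<noteq> 0}, mult = (\<lambda>(a, b) (c, d). (a * c, a * d + b)),
     one = (1, 0)\<rparr>"

lemma group_affine_group: "group affine_group"
proof (rule groupI)
  fix f assume "f \<in> carrier affine_group"
  then obtain a b where f: "f = (a, b)" "a \<noteq> 0" by (auto simp: affine_group_def)
  then show "\<exists>g\<in>carrier affine_group. g \<otimes>\<^bsub>affine_group\<^esub> f = \<one>\<^bsub>affine_group\<^esub>"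
    by (intro bexI[of _ "(1 / a, - b / a)"]) (auto simp: affine_group_def)
qed (auto simp: affine_group_def algebra_simps)

text \<open>This is the composite of the maps \<open>t \<mapsto> N t + i\<close> over the letters
  \<open>i\<close>. The slope records the length; the translation is a base \<open>N\<close>
  expansion with the first letter as lowest digit.\<close>

definition word_affine :: "nat \<Rightarrow> nat list \<Rightarrow> real \<times> real" where
  "word_affine N \<mu> = (real N ^ length \<mu>, horner_sum real (real N) \<mu>)"

lemma word_affine_append:
  "word_affine N (\<mu> @ \<nu>) = word_affine N \<mu> \<otimes>\<^bsub>affine_group\<^esub> word_affine N \<nu>"
  by (simp add: word_affine_def affine_group_def horner_sum_append power_add)

text \<open>The first letter is the remainder modulo \<open>N\<close> and the tail gives the
  quotient. Equal lengths matter: the letter 0 is a digit, and zeros at the end of a word leave the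
  sum unchanged.\<close>

lemma horner_sum_inj:
  fixes N :: nat
  assumes "\<mu> \<in> lists {..<N}" "\<nu> \<in> lists {..<N}" "length \<mu> = length \<nu>"
    and "horner_sum (\<lambda>m. m) N \<mu> = horner_sum (\<lambda>m. m) N \<nu>"
  shows "\<mu> = \<nu>"
  using assms(3,1,2,4)
proof (induction \<mu> \<nu> rule: list_induct2)
  case (Cons i \<mu> j \<nu>)
  then have lt: "i < N" "j < N" by auto
  have eq: "i + N * horner_sum (\<lambda>m. m) N \<mu> = j + N * horner_sum (\<lambda>m. m) N \<nu>" using Cons by simp
  have "i = j" using arg_cong[OF eq, of "\<lambda>m. m mod N"] lt by simp
  with eq lt Cons show ?case by auto
qed simp

text \<open>As \<open>2 \<le> N\<close>, the slope determines the length, and the translation, read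
  as a natural number, then determines the digits.\<close>

lemma word_affine_inj:
  assumes "2 \<le> N" "\<mu> \<in> lists {..<N}" "\<nu> \<in> lists {..<N}" "word_affine N \<mu> = word_affine N \<nu>"
  shows "\<mu> = \<nu>"
proof (rule horner_sum_inj[OF assms(2,3)])
  show "length \<mu> = length \<nu>" using assms by (simp add: word_affine_def)
  have "horner_sum real (real N) \<xi> = real (horner_sum (\<lambda>m. m) N \<xi>)" for \<xi>
    by (induction \<xi>) simp_all
  then show "horner_sum (\<lambda>m. m) N \<mu> = horner_sum (\<lambda>m. m) N \<nu>" using assms by (simp add: word_affine_def)
qed

context word_action
begin

lemma is_functor_word_affine:
  assumes "N \<noteq> 0"
  shows "is_functor (Gam n L \<alpha>) (one_object affine_group) (\<lambda>(\<mu>, x). word_affine N \<mu>)"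
  using assms unfolding is_functor_def one_object_def
  by (auto simp: Gam_simps word_affine_append) (auto simp: word_affine_def affine_group_def)

end

section \<open>Extending automorphisms to the fundamental groupoid\<close>

lemma universal_to_lift:
  fixes G :: "'h cat"
  assumes "universal_to TYPE('h) C P i" "groupoid G" "is_functor C G F"
  shows "\<exists>F'. is_functor P G F' \<and> (\<forall>x\<in>Mor C. F' (i x) = F x)"
  using assms(1)[unfolded universal_to_def, THEN spec, THEN spec, THEN mp, OF conjI, OF assms(2,3)]
  by (elim exE conjE) (intro exI conjI)

text \<open>Both functors solve the lifting problem for \<open>F' \<circ> i\<close>, so each equals
  the distinguished solution \<open>F0\<close> on \<open>Mor P\<close>.\<close>

lemma universal_to_unique:
  fixes G :: "'h cat"
  assumes "universal_to TYPE('h) C P i" "groupoid G" "is_functor C P i"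
    and F: "is_functor P G F" "is_functor P G F'"
    and eq: "\<And>x. x \<in> Mor C \<Longrightarrow> F (i x) = F' (i x)" and p: "p \<in> Mor P"
  shows "F p = F' p"
proof -
  obtain F0 where F0: "\<forall>F''. is_functor P G F'' \<and> (\<forall>x\<in>Mor C. F'' (i x) = (F' \<circ> i) x) \<longrightarrow>
      (\<forall>p\<in>Mor P. F'' p = F0 p)"
    using assms(1)[unfolded universal_to_def, THEN spec, THEN spec, THEN mp, OF conjI,
        OF assms(2) is_functor_comp[OF assms(3) F(2)]]
    by (elim exE conjE)
  show ?thesis
    using F0[THEN spec, of F] F0[THEN spec, of F'] F eq p by simp
qed

text \<open>The functor \<open>i \<circ> g\<close> extends along \<open>i\<close> to an endofunctor
  \<open>\<phi> g\<close> of \<open>P\<close>. The extensions are chosen separately for each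
  \<open>g\<close>; the action laws hold because both sides are functors on \<open>P\<close> that
  agree on the image of \<open>i\<close>.\<close>

lemma fundamental_groupoid_action:
  fixes L :: "('a, 'm) kgraph_scheme" and P :: "'p cat"
  assumes "category L" "fundamental_groupoid L P i"
  obtains \<phi> where "category_action P (Aut L) \<phi>"
    "\<And>g x. g \<in> carrier (Aut L) \<Longrightarrow> x \<in> Mor L \<Longrightarrow> \<phi> g (i x) = i (g x)"
proof -
  have P: "groupoid P" "is_functor L P i" "universal_to TYPE('p) L P i"
    using assms(2) by (simp_all add: fundamental_groupoid_def)
  interpret P: groupoid P by fact
  interpret A: group "Aut L" using assms(1) by (rule group_Aut)
  note unique = universal_to_unique[OF P(3,1,2)]
  have "\<exists>F. is_functor P P F \<and> (\<forall>x\<in>Mor L. F (i x) = i (g x))" if "g \<in> carrier (Aut L)" for g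
    using universal_to_lift[OF P(3,1) is_functor_comp[OF Aut_carrierD(1)[OF that] P(2)]] by simp
  then obtain \<phi> where \<phi>: "\<And>g. g \<in> carrier (Aut L) \<Longrightarrow> is_functor P P (\<phi> g)"
    "\<And>g x. g \<in> carrier (Aut L) \<Longrightarrow> x \<in> Mor L \<Longrightarrow> \<phi> g (i x) = i (g x)"
    by metis
  have one: "\<phi> \<one>\<^bsub>Aut L\<^esub> p = p" if "p \<in> Mor P" for p
    by (rule unique[OF \<phi>(1) is_functor_id _ that])
       (simp_all add: \<phi>(2) Aut_one P.category_axioms)
  have mult: "\<phi> (g \<otimes>\<^bsub>Aut L\<^esub> h) p = \<phi> g (\<phi> h p)"
    if "g \<in> carrier (Aut L)" "h \<in> carrier (Aut L)" "p \<in> Mor P" for g h p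
    using unique[OF \<phi>(1) is_functor_comp[OF \<phi>(1) \<phi>(1)], of "g \<otimes>\<^bsub>Aut L\<^esub> h" h g p] that
    by (simp add: \<phi>(2) Aut_mult is_functorD[OF Aut_carrierD(1)])
  \<comment> \<open>The action laws make \<open>\<phi>\<close> at the group inverse of
    \<open>g\<close> a two-sided inverse of \<open>\<phi> g\<close>.\<close>
  have bij: "bij_betw (\<phi> g) (Mor P) (Mor P)" if g: "g \<in> carrier (Aut L)" for g
    by (rule bij_betw_byWitness[where f' = "\<phi> (inv\<^bsub>Aut L\<^esub> g)"])
       (auto simp: g one is_functorD(1)[OF \<phi>(1)] simp flip: mult)
  have "category_action P (Aut L) \<phi>"
    by unfold_locales (simp_all add: \<phi> bij one mult)
  with \<phi>(2) show thesis using that by blast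
qed

lemma (in word_action) is_functor_crossed:
  assumes i: "is_functor L P i" and act: "category_action P (Aut L) \<phi>"
    and \<phi>: "\<And>g x. g \<in> carrier (Aut L) \<Longrightarrow> x \<in> Mor L \<Longrightarrow> \<phi> g (i x) = i (g x)"
  shows "is_functor (Gam n L \<alpha>) (crossed (Aut L) P \<phi>) (\<lambda>(\<mu>, x). (\<alpha> \<mu>, i x))"
proof -
  interpret P: category_action P "Aut L" \<phi> by fact
  \<comment> \<open>Composition on both sides involves inverses of the actions, so equivariance of
    \<open>i\<close> is first passed on to these.\<close>
  have inv: "P.\<psi> (\<alpha> \<nu>) (i y) = i (A.\<psi> \<nu> y)" if "\<nu> \<in> lists {..<n}" "y \<in> Mor L" for \<nu> y
    by (rule P.act_cancel[of "\<alpha> \<nu>"])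
       (simp_all add: that \<alpha>_simps P.act_inverse \<phi> act_facts(2,3) is_functorD(1)[OF i])
  show ?thesis
    unfolding is_functor_def
  proof (intro conjI ballI impI)
    fix a assume "a \<in> Mor (Gam n L \<alpha>)"
    then obtain \<mu> x where "a = (\<mu>, x)" "\<mu> \<in> lists {..<n}" "x \<in> Mor L"
      by (auto simp: Gam_simps)
    then show "(case a of (\<mu>, x) \<Rightarrow> (\<alpha> \<mu>, i x)) \<in> Mor (crossed (Aut L) P \<phi>)"
      "(case rng (Gam n L \<alpha>) a of (\<mu>, x) \<Rightarrow> (\<alpha> \<mu>, i x)) =
        rng (crossed (Aut L) P \<phi>) (case a of (\<mu>, x) \<Rightarrow> (\<alpha> \<mu>, i x))"
      "(case src (Gam n L \<alpha>) a of (\<mu>, x) \<Rightarrow> (\<alpha> \<mu>, i x)) =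
        src (crossed (Aut L) P \<phi>) (case a of (\<mu>, x) \<Rightarrow> (\<alpha> \<mu>, i x))"
      by (simp_all add: crossed_def Gam_simps \<alpha>_simps is_functorD(1)[OF i] \<phi> rng_Mor
          flip: is_functorD(2,3)[OF i])
  next
    fix a b assume "a \<in> Mor (Gam n L \<alpha>)" "b \<in> Mor (Gam n L \<alpha>)"
      "src (Gam n L \<alpha>) a = rng (Gam n L \<alpha>) b"
    then obtain \<mu> x \<nu> y where ab: "a = (\<mu>, x)" "b = (\<nu>, y)"
      "\<mu> \<in> lists {..<n}" "\<nu> \<in> lists {..<n}" "x \<in> Mor L" "y \<in> Mor L"
      "src L x = \<alpha> \<nu> (rng L y)"
      by (cases a; cases b) (auto simp only: Gam_simps mem_Sigma_iff prod.inject)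
    have "src L (A.\<psi> \<nu> x) = rng L y"
      using ab(7) composable_iff[OF ab(4,5,6)] by blast
    with ab(1-6) show "(case cmp (Gam n L \<alpha>) a b of (\<mu>, x) \<Rightarrow> (\<alpha> \<mu>, i x)) =
        cmp (crossed (Aut L) P \<phi>) (case a of (\<mu>, x) \<Rightarrow> (\<alpha> \<mu>, i x))
          (case b of (\<mu>, x) \<Rightarrow> (\<alpha> \<mu>, i x))"
      by (simp add: crossed_def Gam_simps \<alpha>_simps inv act_facts(2) is_functorD(4)[OF i]
          flip: P.\<psi>_def)
  qed
qed

theorem corollary3p18:
  fixes k n :: nat
    and \<Lambda> :: "'a kgraph"
    and \<alpha> :: "nat list \<Rightarrow> 'a \<Rightarrow> 'a"
    and P :: "'p cat" and i\<^sub>\<Lambda> :: "'a \<Rightarrow> 'p"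
    and Q :: "'q cat" and i\<^sub>\<Gamma> :: "nat list \<times> 'a \<Rightarrow> 'q"
  assumes "k_graph k \<Lambda>"
    and "is_functor (Bn n) (one_object (Aut \<Lambda>)) \<alpha>"
  shows "k_graph (k + 1) (Gam n \<Lambda> \<alpha>) \<and>
    (fundamental_groupoid \<Lambda> P i\<^sub>\<Lambda> \<and> fundamental_groupoid (Gam n \<Lambda> \<alpha>) Q i\<^sub>\<Gamma> \<and>
       inj_on i\<^sub>\<Lambda> (Mor \<Lambda>) \<longrightarrow>
     inj_on i\<^sub>\<Gamma> (Mor (Gam n \<Lambda> \<alpha>)))"
proof (intro conjI impI)
  interpret word_action k \<Lambda> n \<alpha>
    using assms by (simp add: word_action_def word_action_axioms_def)
  show "k_graph (k + 1) (Gam n \<Lambda> \<alpha>)" by (rule k_graph_Gam)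
  assume "fundamental_groupoid \<Lambda> P i\<^sub>\<Lambda> \<and> fundamental_groupoid (Gam n \<Lambda> \<alpha>) Q i\<^sub>\<Gamma> \<and>
    inj_on i\<^sub>\<Lambda> (Mor \<Lambda>)"
  then have P: "fundamental_groupoid \<Lambda> P i\<^sub>\<Lambda>" "groupoid P" "is_functor \<Lambda> P i\<^sub>\<Lambda>"
    and Q: "fundamental_groupoid (Gam n \<Lambda> \<alpha>) Q i\<^sub>\<Gamma>"
    and inj: "inj_on i\<^sub>\<Lambda> (Mor \<Lambda>)"
    by (simp_all add: fundamental_groupoid_def)
  obtain \<phi> where \<phi>: "category_action P (Aut \<Lambda>) \<phi>"
    "\<And>g x. g \<in> carrier (Aut \<Lambda>) \<Longrightarrow> x \<in> Mor \<Lambda> \<Longrightarrow> \<phi> g (i\<^sub>\<Lambda> x) = i\<^sub>\<Lambda> (g x)"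
    using fundamental_groupoid_action[OF category_axioms P(1)] by blast
  \<comment> \<open>The semidirect product sees \<open>\<mu>\<close> only through
    \<open>\<alpha> \<mu>\<close>, and \<open>\<alpha>\<close> need not be injective; hence a
    separate functor for words. Base \<open>n + 2\<close> makes every letter a digit and keeps the
    base at least 2 even when \<open>n\<close> is 0.\<close>
  obtain F where F: "\<forall>a\<in>Mor (Gam n \<Lambda> \<alpha>). F (i\<^sub>\<Gamma> a) = (\<lambda>(\<mu>, x). word_affine (n + 2) \<mu>) a"
    using universal_to_lift[OF fundamental_groupoid_universal[OF category_Gam Q]
        groupoid_one_object[OF group_affine_group] is_functor_word_affine[of "n + 2"]]
    by auto
  \<comment> \<open>Morphisms of the target are pairs of an automorphism and a morphism of
    \<open>P\<close>; \<open>fundamental_groupoid_universal\<close> makes the universal property of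
    \<open>Q\<close> available over their type.\<close>
  obtain H where H: "\<forall>a\<in>Mor (Gam n \<Lambda> \<alpha>). H (i\<^sub>\<Gamma> a) = (\<lambda>(\<mu>, x). (\<alpha> \<mu>, i\<^sub>\<Lambda> x)) a"
    using universal_to_lift[OF fundamental_groupoid_universal[OF category_Gam Q]
        category_action.groupoid_crossed[OF \<phi>(1) P(2) group_Aut[OF category_axioms]]
        is_functor_crossed[OF P(3) \<phi>]]
    by auto
  show "inj_on i\<^sub>\<Gamma> (Mor (Gam n \<Lambda> \<alpha>))"
  proof (rule inj_onI)
    fix a b assume ab: "a \<in> Mor (Gam n \<Lambda> \<alpha>)" "b \<in> Mor (Gam n \<Lambda> \<alpha>)" "i\<^sub>\<Gamma> a = i\<^sub>\<Gamma> b"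
    obtain \<mu> x \<nu> y where mx: "a = (\<mu>, x)" "b = (\<nu>, y)" "\<mu> \<in> lists {..<n}" "x \<in> Mor \<Lambda>"
      "\<nu> \<in> lists {..<n}" "y \<in> Mor \<Lambda>"
      using ab by (auto simp: Gam_simps)
    have "word_affine (n + 2) \<mu> = word_affine (n + 2) \<nu>"
      using F ab mx by (metis case_prod_conv)
    then have "\<mu> = \<nu>"
      using mx by (intro word_affine_inj[of "n + 2"]) auto
    moreover have "i\<^sub>\<Lambda> x = i\<^sub>\<Lambda> y" using H ab mx by (metis case_prod_conv prod.inject)
    then have "x = y" using inj mx by (auto dest: inj_onD)
    ultimately show "a = b" using mx by simp
  qed
qed

end
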